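(* Let $0<q<1$ and let $a,b,c\in\mathbb{C}$ with $a\ne0$, $c\ne0$ and $aq^k\neq1$, $cq^k\ne-1$, $abq^k\neq1$ for all $k=1,2,3,\ldots$. Let $P_n(x)=P_n(x;a,b,-c;q)$ be the big $q$-Jacobi polynomials, and let $$(Lf)(x):=\frac{(1-x)(1+bc^{-1}x)\,f(qx)-(1-a^{-1}q^{-1}x)(1+c^{-1}q^{-1}x)\,f(q^{-1}x)}{x}.$$ Then for all $n\ge0$ the following structure relation holds: $$(LP_n)(x)=\frac{(1-aq^{n+1})(1+cq^{n+1})(1-abq^{n+1})}{q^{n+2}ac(1-abq^{2n+1})}\,P_{n+1}(x)-\frac{(1-q^n)(1-bq^n)(1+abc^{-1}q^n)}{1-abq^{2n+1}}\,P_{n-1}(x).$$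
   Context: $q$-Pochhammer symbols: $(u;q)_k=\prod_{j=0}^{k-1}(1-uq^j)$, $(u_1,\dots,u_r;q)_k=\prod_i(u_i;q)_k$. The big $q$-Jacobi polynomials are $$P_n(x;a,b,-c;q)=\sum_{k=0}^n\frac{(q^{-n},abq^{n+1},x;q)_k}{(aq,-cq,q;q)_k}\,q^k\qquad(n\ge0),$$ and $P_{-1}:=0$. *)

theory Defs
  imports Complex_Main
begin

definition qpoch :: "complex \<Rightarrow> complex \<Rightarrow> nat \<Rightarrow> complex" where
  "qpoch u q k = (\<Prod>j<k. 1 - u * q ^ j)"

definition qpochs :: "complex list \<Rightarrow> complex \<Rightarrow> nat \<Rightarrow> complex" where
  "qpochs us q k = (\<Prod>u\<leftarrow>us. qpoch u q k)"

(* P_n(x; a, b, d; q) with the usual third parameter d, so that P_n(x; a, b, -c; q) is the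
   instance d = -c.  The degree is an integer to allow for the convention P_{-1} = 0. *)
definition big_q_jacobi ::
  "int \<Rightarrow> complex \<Rightarrow> complex \<Rightarrow> complex \<Rightarrow> complex \<Rightarrow> complex \<Rightarrow> complex" where
  "big_q_jacobi n x a b d q =
     (if n < 0 then 0
      else \<Sum>k\<le>nat n.
        qpochs [q powi (- n), a * b * q powi (n + 1), x] q k
          / qpochs [a * q, d * q, q] q k * q ^ k)"

definition L_quotient ::
  "complex \<Rightarrow> complex \<Rightarrow> complex \<Rightarrow> complex \<Rightarrow> (complex \<Rightarrow> complex) \<Rightarrow> complex \<Rightarrow> complex" where
  "L_quotient a b c q f x =
     ((1 - x) * (1 + b * inverse c * x) * f (q * x)
       - (1 - inverse a * inverse q * x) * (1 + inverse c * inverse q * x) * f (inverse q * x)) / x"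

(* For polynomial f the numerator vanishes at 0, so L f is again a polynomial; its value at 0 is
   that of the continuous extension, and not the one given by the convention y / 0 = 0. *)
definition L_op ::
  "complex \<Rightarrow> complex \<Rightarrow> complex \<Rightarrow> complex \<Rightarrow> (complex \<Rightarrow> complex) \<Rightarrow> complex \<Rightarrow> complex" where
  "L_op a b c q f x =
     (if x = 0 then Lim (at 0) (L_quotient a b c q f) else L_quotient a b c q f x)"

end

theory Submission
  imports Defs
begin

text \<open>
  The operator sends \<open>(x;q)\<^bsub>k\<^esub>\<close> to a combination of \<open>(x;q)\<^bsub>k+1\<^esub>\<close>, \<open>(x;q)\<^bsub>k\<^esub>\<close> and
  \<open>(x;q)\<^bsub>k-1\<^esub>\<close>: both \<open>(1 - x)(qx;q)\<^bsub>k\<^esub>\<close> and \<open>(x/q;q)\<^bsub>k\<^esub>\<close> are multiples of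
  \<open>(x;q)\<^bsub>k-1\<^esub>\<close>, and the cofactor that remains is a cubic vanishing at \<open>0\<close>.  Comparing the
  coefficients of \<open>(x;q)\<^bsub>k\<^esub>\<close> on both sides of the structure relation and dividing by their common
  \<open>q\<close>-shifted factorials leaves a rational identity in \<open>a, b, c, q\<close>, \<open>N = q\<^sup>n\<close> and \<open>Q = q\<^sup>k\<close>.
\<close>

section \<open>Shifted factorials\<close>

lemma qpoch_0 [simp]: "qpoch u q 0 = 1"
  by (simp add: qpoch_def)

lemma qpoch_Suc: "qpoch u q (Suc k) = qpoch u q k * (1 - u * q ^ k)"
  by (simp add: qpoch_def)

lemma qpoch_Suc_shift: "qpoch u q (Suc k) = (1 - u) * qpoch (u * q) q k"
  unfolding qpoch_def prod.lessThan_Suc_shift by (simp add: mult.assoc)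

lemma qpoch_inverse_power_eq_0:
  assumes "q \<noteq> 0" "n < k"
  shows "qpoch (inverse (q ^ n)) q k = 0"
proof -
  have "1 - inverse (q ^ n) * q ^ n = 0"
    using assms by simp
  with assms(2) show ?thesis
    unfolding qpoch_def by (intro prod_zero) auto
qed

lemma continuous_on_qpoch [continuous_intros]:
  "continuous_on A f \<Longrightarrow> continuous_on A (\<lambda>x. qpoch (f x) q k)"
  unfolding qpoch_def by (intro continuous_intros)

section \<open>Expansion of the polynomials in the basis \<open>(x;q)_k\<close>\<close>

text \<open>
  \<open>s\<close> and \<open>t\<close> stand for \<open>q\<^bsup>-n\<^esup>\<close> and \<open>abq\<^bsup>n+1\<^esup>\<close>; a shift of the degree multiplies
  one of them by \<open>q\<close> and divides the other by \<open>q\<close>.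
\<close>
definition bqj_coeff :: "complex \<Rightarrow> complex \<Rightarrow> complex \<Rightarrow> complex \<Rightarrow> complex \<Rightarrow> nat \<Rightarrow> complex" where
  "bqj_coeff a c q s t k =
     qpoch s q k * qpoch t q k * q ^ k / (qpoch (a * q) q k * qpoch (- c * q) q k * qpoch q q k)"

text \<open>The factor \<open>(q^-n;q)_k\<close> vanishes for \<open>k > n\<close>, so the upper
  limit can be raised freely. This puts polynomials of different degrees over one index
  range.\<close>

lemma big_q_jacobi_eq_sum:
  assumes "q \<noteq> 0" "n \<le> m"
  shows "big_q_jacobi (int n) x a b (- c) q =
    (\<Sum>k\<le>m. bqj_coeff a c q (inverse (q ^ n)) (a * b * q ^ (n + 1)) k * qpoch x q k)"
proof -
  have pw: "q powi (int n + 1) = q ^ (n + 1)"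
    by (metis of_nat_1 of_nat_add power_int_of_nat)
  have "big_q_jacobi (int n) x a b (- c) q =
    (\<Sum>k\<le>n. bqj_coeff a c q (inverse (q ^ n)) (a * b * q ^ (n + 1)) k * qpoch x q k)"
    by (simp add: big_q_jacobi_def bqj_coeff_def qpochs_def pw power_int_minus
        mult_ac flip: power_Suc)
  also have "\<dots> = (\<Sum>k\<le>m. bqj_coeff a c q (inverse (q ^ n)) (a * b * q ^ (n + 1)) k * qpoch x q k)"
    using assms by (intro sum.mono_neutral_left) (auto simp: bqj_coeff_def qpoch_inverse_power_eq_0)
  finally show ?thesis .
qed

section \<open>Action of the operator on the basis\<close>

text \<open>
  The weights with which \<open>(x;q)\<^bsub>k+1\<^esub>\<close>, \<open>(x;q)\<^bsub>k-1\<^esub>\<close> and \<open>(x;q)\<^bsub>k\<^esub>\<close> occur in the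
  image of \<open>(x;q)\<^bsub>k\<^esub>\<close>, for \<open>Q = q\<^sup>k\<close>.
\<close>
definition L_up :: "complex \<Rightarrow> complex \<Rightarrow> complex \<Rightarrow> complex \<Rightarrow> complex \<Rightarrow> complex" where
  "L_up a b c q Q = b / c - 1 / (a * c * q\<^sup>2 * Q\<^sup>2)"

definition L_down :: "complex \<Rightarrow> complex \<Rightarrow> complex \<Rightarrow> complex \<Rightarrow> complex" where
  "L_down a c q Q = - (1 - a * Q) * (1 + c * Q) * (1 - Q) / (a * c * q * Q\<^sup>2)"

definition L_diag :: "complex \<Rightarrow> complex \<Rightarrow> complex \<Rightarrow> complex \<Rightarrow> complex \<Rightarrow> complex" where
  "L_diag a b c q Q =
     b / c - Q / q - Q + 1 / (a * q) - 1 / (c * q) + 1 / q - L_up a b c q Q - L_down a c q Q"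

lemma L_down_1 [simp]: "L_down a c q 1 = 0"
  by (simp add: L_down_def)

text \<open>Dividing the left side by \<open>x\<close> leaves a quadratic, expanded in the basis
  \<open>1\<close>, \<open>1 - x * Q / q\<close>, \<open>(1 - x * Q / q) * (1 - x * Q)\<close>. Its
  leading coefficient gives \<open>L_up\<close>, its value at \<open>x = q / Q\<close> gives
  \<open>L_down\<close>, and its value at \<open>x = 0\<close> then fixes
  \<open>L_diag\<close>.\<close>

lemma L_cubic_identity:
  assumes "a \<noteq> 0" "c \<noteq> 0" "q \<noteq> 0" "Q \<noteq> 0"
  shows "(1 + b * inverse c * x) * (1 - x * Q / q) * (1 - x * Q)
      - (1 - inverse a * inverse q * x) * (1 + inverse c * inverse q * x) * (1 - x / q) =
    x * (L_up a b c q Q * (1 - x * Q / q) * (1 - x * Q) + L_diag a b c q Q * (1 - x * Q / q)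
      + L_down a c q Q)"
  using assms unfolding L_diag_def L_up_def L_down_def
  by (simp add: divide_simps) algebra

text \<open>The case \<open>k = 0\<close>, where there is no \<open>(x;q)_(k-1)\<close> to factor
  out: this is the cubic identity at \<open>Q = 1\<close> with the common factor
  \<open>1 - x / q\<close> cancelled.\<close>

lemma L_quadratic_identity:
  assumes "a \<noteq> 0" "c \<noteq> 0" "q \<noteq> 0"
  shows "(1 - x) * (1 + b * inverse c * x)
      - (1 - inverse a * inverse q * x) * (1 + inverse c * inverse q * x) =
    x * (L_up a b c q 1 * (1 - x) + L_diag a b c q 1)"
  using assms unfolding L_diag_def L_up_def L_down_def
  by (simp add: divide_simps) algebra

text \<open>At \<open>k = 0\<close> the truncated index \<open>k - 1\<close> is harmless, because
  \<open>L_down\<close> vanishes at \<open>Q = 1\<close>.\<close>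

lemma L_quotient_qpoch:
  assumes "a \<noteq> 0" "c \<noteq> 0" "q \<noteq> 0" "x \<noteq> 0"
  shows "L_quotient a b c q (\<lambda>y. qpoch y q k) x =
    L_up a b c q (q ^ k) * qpoch x q (Suc k) + L_diag a b c q (q ^ k) * qpoch x q k
      + L_down a c q (q ^ k) * qpoch x q (k - 1)"
proof (cases k)
  case 0
  then show ?thesis
    using L_quadratic_identity[OF assms(1-3), of x b] assms(4)
    by (simp add: L_quotient_def qpoch_Suc)
next
  case (Suc j)
  define Q where "Q = q ^ k"
  have Q: "Q \<noteq> 0" "q ^ j = Q / q" "q ^ Suc j = Q"
    using assms by (auto simp: Q_def Suc)
  define F where "F = qpoch x q j"
  have up: "(1 - x) * qpoch (q * x) q k = F * (1 - x * Q / q) * (1 - x * Q)"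
    using qpoch_Suc_shift[of x q k] unfolding Suc qpoch_Suc F_def Q by (simp add: mult_ac)
  have down: "qpoch (inverse q * x) q k = (1 - x / q) * F"
    using assms by (simp add: Suc qpoch_Suc_shift F_def field_simps)
  have "L_quotient a b c q (\<lambda>y. qpoch y q k) x =
     F * ((1 + b * inverse c * x) * (1 - x * Q / q) * (1 - x * Q)
      - (1 - inverse a * inverse q * x) * (1 + inverse c * inverse q * x) * (1 - x / q)) / x"
    unfolding L_quotient_def down mult.commute[of "1 - x" "1 + _"] mult.assoc up
    by (simp add: algebra_simps)
  also have "\<dots> = F * (L_up a b c q Q * (1 - x * Q / q) * (1 - x * Q)
      + L_diag a b c q Q * (1 - x * Q / q) + L_down a c q Q)"
    unfolding L_cubic_identity[OF assms(1-3) Q(1)] using assms(4) by simp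
  finally show ?thesis
    unfolding Q_def[symmetric] unfolding Suc qpoch_Suc F_def[symmetric] diff_Suc_1 Q
    by (simp add: algebra_simps)
qed

section \<open>Linearity and collection of coefficients\<close>

lemma L_quotient_sum:
  "L_quotient a b c q (\<lambda>y. \<Sum>k\<in>A. w k * f k y) x = (\<Sum>k\<in>A. w k * L_quotient a b c q (f k) x)"
  unfolding L_quotient_def sum_distrib_left sum_subtractf[symmetric] sum_divide_distrib
  by (intro sum.cong refl) (simp add: algebra_simps)

text \<open>Collects the coefficient of each \<open>f k\<close>. The two zeros of \<open>w\<close>
  allow the ranges to be extended to a common one after shifting, and \<open>d 0 = 0\<close> removes
  the term in which \<open>k - 1\<close> truncates.\<close>

lemma sum_three_term_reindex:
  fixes w :: "nat \<Rightarrow> 'a::comm_ring"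
  assumes "w (Suc m) = 0" "w (Suc (Suc m)) = 0" "d 0 = 0"
  shows "(\<Sum>k\<le>m. w k * (u k * f (Suc k) + v k * f k + d k * f (k - 1))) =
    (\<Sum>k\<le>Suc m. ((case k of 0 \<Rightarrow> 0 | Suc j \<Rightarrow> w j * u j) + w k * v k + w (Suc k) * d (Suc k)) * f k)"
proof -
  have "(\<Sum>k\<le>m. w k * d k * f (k - 1)) = (\<Sum>k\<le>Suc (Suc m). w k * d k * f (k - 1))"
    using assms by simp
  also have "\<dots> = (\<Sum>k\<le>Suc m. w (Suc k) * d (Suc k) * f k)"
    unfolding sum.atMost_Suc_shift[of _ "Suc m"] using assms by simp
  finally have 1: "(\<Sum>k\<le>m. w k * d k * f (k - 1)) = (\<Sum>k\<le>Suc m. w (Suc k) * d (Suc k) * f k)" .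
  have 2: "(\<Sum>k\<le>m. w k * u k * f (Suc k)) =
    (\<Sum>k\<le>Suc m. (case k of 0 \<Rightarrow> 0 | Suc j \<Rightarrow> w j * u j) * f k)"
    unfolding sum.atMost_Suc_shift by simp
  have 3: "(\<Sum>k\<le>m. w k * v k * f k) = (\<Sum>k\<le>Suc m. w k * v k * f k)"
    using assms by simp
  have "(\<Sum>k\<le>m. w k * (u k * f (Suc k) + v k * f k + d k * f (k - 1))) =
    (\<Sum>k\<le>m. w k * u k * f (Suc k)) + (\<Sum>k\<le>m. w k * v k * f k) + (\<Sum>k\<le>m. w k * d k * f (k - 1))"
    by (simp add: sum.distrib algebra_simps)
  then show ?thesis
    unfolding 1 2 3 by (simp add: sum.distrib distrib_right)
qed

section \<open>Comparison of coefficients\<close>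

text \<open>The comparison for \<open>k > 0\<close>: on the left the contributions of the indices
  \<open>k - 1\<close>, \<open>k\<close>, \<open>k + 1\<close>, on the right those of degrees
  \<open>n + 1\<close> and \<open>n - 1\<close>. The plus sign and the factor \<open>N\<close> on
  the right come from \<open>1 - N = - N * (1 - 1 / N)\<close>.\<close>

lemma coeff_identity_core:
  fixes a b c q N Q :: complex
  assumes "a \<noteq> 0" "c \<noteq> 0" "q \<noteq> 0" "N \<noteq> 0" "Q \<noteq> 0" "1 - a * b * q * N\<^sup>2 \<noteq> 0"
  shows "L_up a b c q (Q / q) * (1 - a * Q) * (1 + c * Q) * (1 - Q) / q
      + L_diag a b c q Q * (1 - Q / (q * N)) * (1 - a * b * N * Q)
      - (1 - Q / (q * N)) * (1 - Q / N) * (1 - a * b * N * Q) * (1 - a * b * N * Q * q)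
        / (a * c * q\<^sup>2 * Q\<^sup>2) =
    (1 - a * q * N) * (1 + c * q * N) / (q\<^sup>2 * N * a * c * (1 - a * b * q * N\<^sup>2))
      * (1 - 1 / (N * q)) * (1 - a * b * N * Q) * (1 - a * b * N * Q * q)
    + N * (1 - b * N) * (1 + a * b / c * N) / (1 - a * b * q * N\<^sup>2)
      * (1 - a * b * N) * (1 - Q / (q * N)) * (1 - Q / N)"
  using assms unfolding L_diag_def L_up_def L_down_def
  by (simp add: divide_simps) algebra

text \<open>This is the previous identity at \<open>Q = 1\<close> divided by
  \<open>(1 - 1 / (q * N)) * (1 - a * b * N)\<close>; it is stated separately because that factor
  may vanish.\<close>

lemma coeff_identity_core_0:
  fixes a b c q N :: complex
  assumes "a \<noteq> 0" "c \<noteq> 0" "q \<noteq> 0" "N \<noteq> 0" "1 - a * b * q * N\<^sup>2 \<noteq> 0"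
  shows "L_diag a b c q 1 - (1 - 1 / N) * (1 - a * b * N * q) / (a * c * q\<^sup>2) =
    (1 - a * q * N) * (1 + c * q * N) * (1 - a * b * N * q) / (q\<^sup>2 * N * a * c * (1 - a * b * q * N\<^sup>2))
    + N * (1 - b * N) * (1 + a * b / c * N) / (1 - a * b * q * N\<^sup>2) * (1 - 1 / N)"
  using assms unfolding L_diag_def L_up_def L_down_def
  by (simp add: divide_simps) algebra

text \<open>The factors \<open>1 - s\<close> and \<open>1 - t\<close> are kept beside the shifted
  coefficients because \<open>(1 - s) (sq;q)_k = (s;q)_(k+1)\<close>, and likewise for
  \<open>t\<close>; every term is then a multiple of one common product.\<close>

lemma bqj_coeff_structure:
  fixes a b c q N :: complex and k :: nat
  assumes nz: "a \<noteq> 0" "c \<noteq> 0" "q \<noteq> 0" "N \<noteq> 0"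
    and "1 - a * b * q * N\<^sup>2 \<noteq> 0" "1 - a * b * q * N \<noteq> 0"
    and den: "\<And>j. a * q ^ Suc j \<noteq> 1" "\<And>j. c * q ^ Suc j \<noteq> - 1" "\<And>j. q ^ Suc j \<noteq> 1"
  defines "s \<equiv> inverse N" and "t \<equiv> a * b * q * N"
  defines "w \<equiv> bqj_coeff a c q s t"
  shows "(case k of 0 \<Rightarrow> 0 | Suc j \<Rightarrow> w j * L_up a b c q (q ^ j)) + w k * L_diag a b c q (q ^ k)
      + w (Suc k) * L_down a c q (q ^ Suc k) =
    (1 - a * q * N) * (1 + c * q * N) * (1 - a * b * q * N)
      / (q\<^sup>2 * N * a * c * (1 - a * b * q * N\<^sup>2)) * bqj_coeff a c q (s / q) (t * q) k
    + N * (1 - b * N) * (1 + a * b / c * N) / (1 - a * b * q * N\<^sup>2)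
      * ((1 - s) * bqj_coeff a c q (s * q) (t / q) k)"
proof -
  define D where "D k = qpoch (a * q) q k * qpoch (- c * q) q k * qpoch q q k" for k
  have D_Suc: "D (Suc k) = D k * ((1 - a * q ^ Suc k) * (1 + c * q ^ Suc k) * (1 - q ^ Suc k))" for k
    by (simp add: D_def qpoch_Suc mult_ac)
  have fac: "1 - a * q ^ Suc j \<noteq> 0" "1 + c * q ^ Suc j \<noteq> 0" "1 - q ^ Suc j \<noteq> 0" for j
    using den[of j] by (auto simp: add_eq_0_iff)
  have D_nz: "D k \<noteq> 0" for k
  proof (induction k)
    case 0
    show ?case
      by (simp add: D_def)
  next
    case (Suc k)
    then show ?case
      unfolding D_Suc by (intro no_zero_divisors fac)
  qed
  \<comment> \<open>The numerator of \<open>L_down\<close> cancels exactly the last factor of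
    \<open>D (Suc k)\<close>, so only \<open>D k\<close> stays in the denominator.\<close>
  have down: "w (Suc k) * L_down a c q (q ^ Suc k) =
    - (qpoch s q (Suc k) * qpoch t q (Suc k) / (D k * (a * c * q * q ^ Suc k)))" for k
  proof -
    define R where "R = q ^ Suc k"
    have *: "R \<noteq> 0" "1 - a * R \<noteq> 0" "1 + c * R \<noteq> 0" "1 - R \<noteq> 0"
      using fac[of k] nz by (auto simp: R_def)
    show ?thesis
      unfolding w_def bqj_coeff_def D_def[symmetric] D_Suc L_down_def R_def[symmetric]
      using * D_nz[of k] nz by (simp add: divide_simps power2_eq_square) (simp add: algebra_simps)
  qed
  show ?thesis
  proof (cases k)
    case 0
    have "w 1 * L_down a c q q = - ((1 - 1 / N) * (1 - a * b * N * q) / (a * c * q\<^sup>2))"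
      using down[of 0] by (simp add: qpoch_Suc D_def s_def t_def power2_eq_square field_simps)
    then show ?thesis
      using coeff_identity_core_0[OF nz assms(5)] 0
      by (simp add: w_def bqj_coeff_def s_def inverse_eq_divide mult_ac)
  next
    case (Suc j)
    define Q where "Q = q ^ Suc j"
    have Q: "Q \<noteq> 0" "q ^ j = Q / q"
      using nz by (auto simp: Q_def)
    define X where "X = qpoch s q j"
    define Y where "Y = qpoch t q j"
    \<comment> \<open>The common factor of all terms: numerator products up to index
      \<open>k - 1\<close>, denominator up to index \<open>k\<close>.\<close>
    define Z where "Z = X * Y * Q / D k"
    have s: "qpoch s q k = X * (1 - Q / (q * N))"
      unfolding Suc qpoch_Suc X_def Q by (simp add: s_def field_simps)
    have t: "qpoch t q k = Y * (1 - a * b * N * Q)"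
      unfolding Suc qpoch_Suc Y_def Q using nz by (simp add: t_def field_simps)
    have s': "qpoch s q (Suc k) = X * (1 - Q / (q * N)) * (1 - Q / N)"
      unfolding qpoch_Suc[of _ _ k] s by (simp add: Suc Q_def[simplified] s_def field_simps)
    have t': "qpoch t q (Suc k) = Y * (1 - a * b * N * Q) * (1 - a * b * N * Q * q)"
      unfolding qpoch_Suc[of _ _ k] t by (simp add: Suc Q_def[simplified] t_def mult_ac)
    have e1: "w j = Z * ((1 - a * Q) * (1 + c * Q) * (1 - Q) / q)"
    proof -
      have "D k = D j * ((1 - a * Q) * (1 + c * Q) * (1 - Q))"
        by (simp add: Suc D_Suc Q_def)
      moreover have "1 - a * Q \<noteq> 0" "1 + c * Q \<noteq> 0" "1 - Q \<noteq> 0"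
        unfolding Q_def by (rule fac)+
      ultimately show ?thesis
        unfolding Z_def w_def bqj_coeff_def D_def[symmetric] X_def Y_def Q
        by simp
    qed
    have e2: "w k = Z * ((1 - Q / (q * N)) * (1 - a * b * N * Q))"
      unfolding Z_def w_def bqj_coeff_def D_def[symmetric] s t
      by (simp add: Suc Q_def)
    have e3: "w (Suc k) * L_down a c q (q ^ Suc k) =
      - (Z * ((1 - Q / (q * N)) * (1 - Q / N) * (1 - a * b * N * Q) * (1 - a * b * N * Q * q)
        / (a * c * q\<^sup>2 * Q\<^sup>2)))"
    proof -
      have "q ^ Suc k = q * Q"
        by (simp add: Suc Q_def)
      then show ?thesis
        unfolding down s' t' Z_def using D_nz[of k] Q nz by (simp add: power2_eq_square mult_ac)
    qed
    \<comment> \<open>Raising the degree prepends a factor to \<open>(s;q)_j\<close>, while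
      \<open>1 - t\<close> completes \<open>(tq;q)_k\<close> to \<open>(t;q)_(k+1)\<close>. For the
      lower degree in \<open>e5\<close> the roles of \<open>s\<close> and \<open>t\<close> are
      exchanged.\<close>
    have e4: "(1 - a * b * q * N) * bqj_coeff a c q (s / q) (t * q) k =
      Z * ((1 - 1 / (N * q)) * (1 - a * b * N * Q) * (1 - a * b * N * Q * q))"
    proof -
      have "qpoch (s / q) q k = (1 - 1 / (N * q)) * X"
        using nz by (simp add: Suc qpoch_Suc_shift X_def s_def inverse_eq_divide)
      moreover have "(1 - a * b * q * N) * qpoch (t * q) q k =
          Y * (1 - a * b * N * Q) * (1 - a * b * N * Q * q)"
        using qpoch_Suc_shift[of t q k] t' by (simp add: t_def)
      ultimately show ?thesis
        unfolding Z_def bqj_coeff_def D_def[symmetric]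
        by (simp add: Suc Q_def mult_ac)
    qed
    have e5: "(1 - s) * bqj_coeff a c q (s * q) (t / q) k =
      Z * ((1 - a * b * N) * (1 - Q / (q * N)) * (1 - Q / N))"
    proof -
      have "qpoch (t / q) q k = (1 - a * b * N) * Y"
        using nz by (simp add: Suc qpoch_Suc_shift Y_def t_def mult_ac)
      moreover have "(1 - s) * qpoch (s * q) q k = X * (1 - Q / (q * N)) * (1 - Q / N)"
        using qpoch_Suc_shift[of s q k] s' by simp
      ultimately show ?thesis
        unfolding Z_def bqj_coeff_def D_def[symmetric]
        by (simp add: Suc Q_def mult_ac)
    qed
    have "(case k of 0 \<Rightarrow> 0 | Suc j \<Rightarrow> w j * L_up a b c q (q ^ j)) + w k * L_diag a b c q (q ^ k)
        + w (Suc k) * L_down a c q (q ^ Suc k) =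
      Z * (L_up a b c q (Q / q) * (1 - a * Q) * (1 + c * Q) * (1 - Q) / q
        + L_diag a b c q Q * (1 - Q / (q * N)) * (1 - a * b * N * Q)
        - (1 - Q / (q * N)) * (1 - Q / N) * (1 - a * b * N * Q) * (1 - a * b * N * Q * q)
          / (a * c * q\<^sup>2 * Q\<^sup>2))"
    proof -
      have "(case k of 0 \<Rightarrow> 0 | Suc j \<Rightarrow> w j * L_up a b c q (q ^ j)) =
          Z * (L_up a b c q (Q / q) * (1 - a * Q) * (1 + c * Q) * (1 - Q) / q)"
        by (simp add: Suc e1 Q mult_ac)
      moreover have "w k * L_diag a b c q (q ^ k) =
          Z * (L_diag a b c q Q * (1 - Q / (q * N)) * (1 - a * b * N * Q))"
        unfolding e2 by (simp add: Suc Q_def mult_ac)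
      ultimately show ?thesis
        unfolding e3 by (simp only: distrib_left right_diff_distrib diff_conv_add_uminus[symmetric])
    qed
    also have "\<dots> = (1 - a * q * N) * (1 + c * q * N)
          / (q\<^sup>2 * N * a * c * (1 - a * b * q * N\<^sup>2))
        * ((1 - a * b * q * N) * bqj_coeff a c q (s / q) (t * q) k)
      + N * (1 - b * N) * (1 + a * b / c * N) / (1 - a * b * q * N\<^sup>2)
        * ((1 - s) * bqj_coeff a c q (s * q) (t / q) k)"
      unfolding coeff_identity_core[OF nz Q(1) assms(5)] e4 e5
      by (simp add: distrib_left mult_ac)
    finally show ?thesis
      by simp
  qed
qed

section \<open>The value at the origin and the structure relation\<close>

text \<open>At \<open>0\<close> the operator is a limit of quotients, and a limit ignores the point
  itself; continuity of \<open>g\<close> identifies it as \<open>g 0\<close>.\<close>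

lemma L_op_eqI:
  assumes "\<And>y. y \<noteq> 0 \<Longrightarrow> L_quotient a b c q f y = g y" "isCont g 0"
  shows "L_op a b c q f x = g x"
proof -
  have "(g \<longlongrightarrow> g 0) (at 0)"
    using assms(2) by (simp add: isCont_def)
  then have "(L_quotient a b c q f \<longlongrightarrow> g 0) (at 0)"
    by (rule Lim_transform_eventually) (auto simp: eventually_at_filter assms(1))
  then have "Lim (at 0) (L_quotient a b c q f) = g 0"
    by (intro tendsto_Lim) auto
  then show ?thesis
    using assms(1) by (simp add: L_op_def)
qed

theorem mainTheorem10:
  fixes q :: real and a b c x :: complex and n :: nat
  fixes P :: "int \<Rightarrow> complex \<Rightarrow> complex"
  assumes "0 < q" and "q < 1"
    and "a \<noteq> 0" and "c \<noteq> 0"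
    and "\<And>k::nat. k \<ge> 1 \<Longrightarrow> a * complex_of_real q ^ k \<noteq> 1"
    and "\<And>k::nat. k \<ge> 1 \<Longrightarrow> c * complex_of_real q ^ k \<noteq> - 1"
    and "\<And>k::nat. k \<ge> 1 \<Longrightarrow> a * b * complex_of_real q ^ k \<noteq> 1"
  defines "P \<equiv> \<lambda>m y. big_q_jacobi m y a b (- c) (complex_of_real q)"
  shows "L_op a b c (complex_of_real q) (P (int n)) x =
      (1 - a * complex_of_real q ^ (n + 1)) * (1 + c * complex_of_real q ^ (n + 1))
          * (1 - a * b * complex_of_real q ^ (n + 1))
        / (complex_of_real q ^ (n + 2) * a * c * (1 - a * b * complex_of_real q ^ (2 * n + 1)))
        * P (int n + 1) x
      - (1 - complex_of_real q ^ n) * (1 - b * complex_of_real q ^ n)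
          * (1 + a * b * inverse c * complex_of_real q ^ n)
        / (1 - a * b * complex_of_real q ^ (2 * n + 1))
        * P (int n - 1) x"
proof -
  define z where "z = complex_of_real q"
  define N where "N = z ^ n"
  define s where "s = inverse N"
  define t where "t = a * b * z * N"
  define w where "w = bqj_coeff a c z s t"
  define A where "A = (1 - a * z * N) * (1 + c * z * N) * (1 - a * b * z * N)
      / (z\<^sup>2 * N * a * c * (1 - a * b * z * N\<^sup>2))"
  define B where "B = N * (1 - b * N) * (1 + a * b / c * N) / (1 - a * b * z * N\<^sup>2)"
  have nz: "a \<noteq> 0" "c \<noteq> 0" "z \<noteq> 0" "N \<noteq> 0"
    using assms(1-4) by (auto simp: z_def N_def)
  have den: "a * z ^ Suc j \<noteq> 1" "c * z ^ Suc j \<noteq> - 1" "z ^ Suc j \<noteq> 1" for j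
    using assms(5,6)[of "Suc j"] power_Suc_less_one[of q j] assms(1,2)
    by (auto simp: z_def simp flip: of_real_power of_real_mult)
  have pow: "z ^ (n + 1) = z * N" "z ^ (n + 2) = z\<^sup>2 * N" "z ^ (2 * n + 1) = z * N\<^sup>2"
    by (simp_all add: N_def power_add power_mult power2_eq_square mult.commute flip: power_mult_distrib)
  have ab: "1 - a * b * z * N\<^sup>2 \<noteq> 0" "1 - a * b * z * N \<noteq> 0"
    using assms(7)[of "2 * n + 1"] assms(7)[of "n + 1"] unfolding z_def[symmetric] pow
    by (auto simp: mult_ac)
  have Pn: "P (int n) y = (\<Sum>k\<le>n. w k * qpoch y z k)" for y
    unfolding P_def z_def[symmetric] big_q_jacobi_eq_sum[OF nz(3) order_refl]
    by (simp add: w_def s_def t_def N_def mult_ac)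
  have up: "P (int n + 1) y = (\<Sum>k\<le>Suc n. bqj_coeff a c z (s / z) (t * z) k * qpoch y z k)" for y
  proof -
    have "inverse (z ^ Suc n) = s / z" "a * b * z ^ (Suc n + 1) = t * z"
      by (simp_all add: s_def t_def N_def inverse_eq_divide)
    moreover have "int n + 1 = int (Suc n)"
      by simp
    ultimately show ?thesis
      unfolding P_def z_def[symmetric] by (simp only: big_q_jacobi_eq_sum[OF nz(3) order_refl])
  qed
  \<comment> \<open>For \<open>n = 0\<close> the sum on the right need not represent
    \<open>P (- 1)\<close>, but then \<open>N = s = 1\<close> and both sides vanish.\<close>
  have down: "(1 - N) * P (int n - 1) y =
    - N * (1 - s) * (\<Sum>k\<le>Suc n. bqj_coeff a c z (s * z) (t / z) k * qpoch y z k)" for y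
  proof (cases n)
    case 0
    then show ?thesis
      by (simp add: N_def s_def)
  next
    case (Suc m)
    have "inverse (z ^ m) = s * z" "a * b * z ^ (m + 1) = t / z"
      using nz(3) by (simp_all add: s_def t_def N_def Suc field_simps)
    then have "P (int n - 1) y = (\<Sum>k\<le>Suc n. bqj_coeff a c z (s * z) (t / z) k * qpoch y z k)"
      using big_q_jacobi_eq_sum[OF nz(3), of m "Suc n" y a b c]
      by (simp add: P_def z_def[symmetric] Suc)
    moreover have "- N * (1 - s) = 1 - N"
      using nz(4) by (simp add: s_def field_simps)
    ultimately show ?thesis
      by simp
  qed
  have w0: "w (Suc n) = 0" "w (Suc (Suc n)) = 0"
    using qpoch_inverse_power_eq_0[OF nz(3)] by (simp_all add: w_def bqj_coeff_def s_def N_def)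
  have quot: "L_quotient a b c z (P (int n)) y =
      A * P (int n + 1) y - B / N * ((1 - N) * P (int n - 1) y)" if "y \<noteq> 0" for y
  proof -
    have "L_quotient a b c z (P (int n)) y =
      (\<Sum>k\<le>n. w k * (L_up a b c z (z ^ k) * qpoch y z (Suc k)
        + L_diag a b c z (z ^ k) * qpoch y z k + L_down a c z (z ^ k) * qpoch y z (k - 1)))"
      unfolding Pn L_quotient_sum L_quotient_qpoch[OF nz(1-3) that] ..
    also have "\<dots> = (\<Sum>k\<le>Suc n. (A * bqj_coeff a c z (s / z) (t * z) k
        + B * ((1 - s) * bqj_coeff a c z (s * z) (t / z) k)) * qpoch y z k)"
      \<comment> \<open>The coefficient relation is read from right to left, which turns the target
        sum into the output of the reindexing.\<close>
      unfolding A_def B_def s_def t_def bqj_coeff_structure[OF nz ab den, symmetric]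
      unfolding s_def[symmetric] t_def[symmetric] w_def[symmetric]
      by (rule sum_three_term_reindex) (simp_all add: w0)
    also have "\<dots> = A * P (int n + 1) y - B / N * ((1 - N) * P (int n - 1) y)"
      unfolding up down sum_distrib_left sum_subtractf[symmetric]
      using nz(4) by (intro sum.cong refl) (simp add: algebra_simps)
    finally show ?thesis .
  qed
  have "L_op a b c z (P (int n)) x =
      A * P (int n + 1) x - B / N * ((1 - N) * P (int n - 1) x)"
  proof (rule L_op_eqI[OF quot])
    \<comment> \<open>Rewriting with \<open>up\<close> and \<open>down\<close> shows the right side
      as a finite combination of shifted factorials in \<open>y\<close>.\<close>
    have "continuous_on UNIV (\<lambda>y. A * P (int n + 1) y - B / N * ((1 - N) * P (int n - 1) y))"
      unfolding up down by (intro continuous_intros)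
    then show "isCont (\<lambda>y. A * P (int n + 1) y - B / N * ((1 - N) * P (int n - 1) y)) 0"
      by (simp add: continuous_on_eq_continuous_at)
  qed
  then show ?thesis
    unfolding z_def[symmetric] pow N_def[symmetric] A_def B_def using nz(4)
    by (simp add: inverse_eq_divide mult_ac)
qed

end
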